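(* Let $\mathbf H_{ii}\in\mathbb C^{N_{\mathrm r}\times N_{\mathrm t}}$ be the self-interference channel, $\mathbf F_{\mathrm{RF}}\in\mathbb C^{N_{\mathrm t}\times L_{\mathrm t}}$ the analog precoder, $\mathbf F_{\mathrm{BB}}\in\mathbb C^{L_{\mathrm t}\times N_{\mathrm s}}$ the digital precoder and $\mathbf W_{\mathrm{RF}}\in\mathbb C^{N_{\mathrm r}\times L_{\mathrm r}}$ the analog combiner of a full-duplex device transmitting $N_{\mathrm s}\ge 1$ streams, and let $\eta_{\mathrm{LNA}},\eta_{\mathrm{ADC}}\ge 0$. If the per-antenna constraint $$\frac1{N_{\mathrm s}}\,\sigma_{\max}^2(\mathbf H_{ii}\mathbf F_{\mathrm{RF}}\mathbf F_{\mathrm{BB}})\le\eta_{\mathrm{LNA}}$$ is satisfied and $$\eta_{\mathrm{ADC}}\ \ge\ \eta_{\mathrm{LNA}}\cdot\sigma_{\max}^2(\mathbf W_{\mathrm{RF}}^{*}),$$ then the per-RF-chain constraint $$\frac1{N_{\mathrm s}}\,\sigma_{\max}^2(\mathbf W_{\mathrm{RF}}^{*}\mathbf H_{ii}\mathbf F_{\mathrm{RF}}\mathbf F_{\mathrm{BB}})\le\eta_{\mathrm{ADC}}$$ is satisfied.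
   Context: $\mathbf A^{*}$ denotes conjugate transpose and $\sigma_{\max}(\mathbf A)$ the largest singular value of $\mathbf A$. $\eta_{\mathrm{LNA}}$ and $\eta_{\mathrm{ADC}}$ are unitless thresholds on the self-interference power at each receive antenna and each receive RF chain. The matrix dimensions $N_{\mathrm t},N_{\mathrm r},L_{\mathrm t},L_{\mathrm r}$ (numbers of transmit antennas, receive antennas, transmit RF chains, receive RF chains) are positive integers. *)

theory Defs
  imports
    "Jordan_Normal_Form.Schur_Decomposition"
    "Jordan_Normal_Form.Spectral_Radius"
begin

(* The square roots of the eigenvalues of A^* A. If A has more columns than rows, this set also
   contains 0; that does not change the largest element, since singular values are nonnegative. *)
definition singular_values :: "complex mat \<Rightarrow> real set" where
  "singular_values A =
     {s. 0 \<le> s \<and> eigenvalue (mat_adjoint A * A) (complex_of_real (s\<^sup>2))}"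

definition sigma_max :: "complex mat \<Rightarrow> real" where
  "sigma_max A = Max (singular_values A)"

lemma mat_adjoint_carrier:
  "A \<in> carrier_mat m n \<Longrightarrow> mat_adjoint A \<in> carrier_mat n m"
  unfolding mat_adjoint_def by auto

lemma mat_adjoint_index:
  fixes A :: "complex mat"
  assumes "A \<in> carrier_mat m n" "i < n" "j < m"
  shows "mat_adjoint A $$ (i, j) = cnj (A $$ (j, i))"
  using assms unfolding mat_adjoint_def by (auto simp: mat_of_rows_index)

lemma finite_singular_values:
  assumes A: "A \<in> carrier_mat m n"
  shows "finite (singular_values A)"
proof -
  have B: "mat_adjoint A * A \<in> carrier_mat n n"
    using A mat_adjoint_carrier[OF A] by auto
  have "(\<lambda>s. complex_of_real (s\<^sup>2)) ` singular_values A \<subseteq> spectrum (mat_adjoint A * A)"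
    by (auto simp: singular_values_def spectrum_def)
  then have "finite ((\<lambda>s. complex_of_real (s\<^sup>2)) ` singular_values A)"
    using card_finite_spectrum(1)[OF B] finite_subset by blast
  moreover have "inj_on (\<lambda>s. complex_of_real (s\<^sup>2)) (singular_values A)"
    by (auto simp: inj_on_def singular_values_def simp del: of_real_power)
  ultimately show ?thesis by (rule finite_imageD)
qed

(* Hence the maximum in sigma_max is over a finite nonempty set. *)
lemma singular_values_nonempty:
  assumes A: "A \<in> carrier_mat m n" and n: "0 < n"
  shows "singular_values A \<noteq> {}"
proof -
  let ?B = "mat_adjoint A * A"
  have A': "mat_adjoint A \<in> carrier_mat n m" by (rule mat_adjoint_carrier[OF A])
  have B: "?B \<in> carrier_mat n n" using A A' by auto
  obtain l where l: "eigenvalue ?B l"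
    using spectrum_non_empty[OF B] n by (auto simp: spectrum_def)
  then obtain v where v: "v \<in> carrier_vec n" "v \<noteq> 0\<^sub>v n" "?B *\<^sub>v v = l \<cdot>\<^sub>v v"
    using B by (auto simp: eigenvalue_def eigenvector_def)
  define w where "w = A *\<^sub>v v"
  have w: "w \<in> carrier_vec m" using A v by (auto simp: w_def)
  have lw: "mat_adjoint A *\<^sub>v w = l \<cdot>\<^sub>v v"
    using v(3) assoc_mult_mat_vec[OF A' A v(1)] unfolding w_def by metis
  define p where "p = (\<Sum>i<n. (cmod (v $ i))\<^sup>2)"
  define q where "q = (\<Sum>j<m. (cmod (w $ j))\<^sup>2)"
  have comp: "(\<Sum>j<m. cnj (A $$ (j, i)) * w $ j) = l * v $ i" if "i < n" for i
  proof -
    have "(mat_adjoint A *\<^sub>v w) $ i = (\<Sum>j<m. cnj (A $$ (j, i)) * w $ j)"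
      using that A' w by (auto simp: scalar_prod_def mat_adjoint_index[OF A] atLeast0LessThan)
    then show ?thesis using lw that v by simp
  qed
  have wj: "w $ j = (\<Sum>i<n. A $$ (j, i) * v $ i)" if "j < m" for j
    using that A v by (auto simp: w_def scalar_prod_def atLeast0LessThan)
  have cw: "cnj (w $ j) = (\<Sum>i<n. cnj (v $ i) * cnj (A $$ (j, i)))" if "j < m" for j
    by (simp add: wj[OF that] mult.commute)
  have "l * of_real p = (\<Sum>i<n. cnj (v $ i) * (l * v $ i))"
    unfolding p_def of_real_sum sum_distrib_left
    by (intro sum.cong refl) (simp add: complex_norm_square mult_ac del: of_real_power)
  also have "\<dots> = (\<Sum>i<n. cnj (v $ i) * (\<Sum>j<m. cnj (A $$ (j, i)) * w $ j))"
    by (intro sum.cong refl) (simp add: comp)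
  also have "\<dots> = (\<Sum>j<m. (\<Sum>i<n. cnj (v $ i) * (cnj (A $$ (j, i)) * w $ j)))"
    by (subst sum.swap) (simp add: sum_distrib_left)
  also have "\<dots> = (\<Sum>j<m. cnj (w $ j) * w $ j)"
    by (intro sum.cong refl) (simp add: cw sum_distrib_right mult.assoc)
  also have "\<dots> = of_real q"
    unfolding q_def of_real_sum
    by (intro sum.cong refl) (simp add: complex_norm_square mult.commute del: of_real_power)
  finally have lp: "l * of_real p = of_real q" .
  obtain i where i: "i < n" "v $ i \<noteq> 0"
    using v(1,2) by (metis carrier_vecD eq_vecI index_zero_vec)
  have p: "p > 0"
    unfolding p_def by (rule sum_pos2[of _ i]) (use i in auto)
  have q: "q \<ge> 0" unfolding q_def by (intro sum_nonneg) auto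
  have "l = complex_of_real (q / p)" using lp p by (simp add: field_simps)
  moreover have "(sqrt (q / p))\<^sup>2 = q / p" using p q by simp
  ultimately have "eigenvalue ?B (complex_of_real ((sqrt (q / p))\<^sup>2))" using l by metis
  then have "sqrt (q / p) \<in> singular_values A"
    unfolding singular_values_def mem_Collect_eq using p q by (intro conjI) (simp, assumption)
  then show ?thesis by auto
qed

end

theory Submission
  imports Defs "HOL-Analysis.L2_Norm"
begin

(* The heart is the variational bound |A v| <= sigma_max A * |v| for the Euclidean norm; applied
   twice to an eigenvector for the largest singular value of W M, it yields
   sigma_max (W M) <= sigma_max W * sigma_max M.
   No spectral theorem is needed for the bound. For Hermitian B, Cauchy-Schwarz makes the sequence
   |B^k v| log-convex, so it grows at least as fast as (|B v| / |v|)^k. If the spectral radius of B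
   is below 1, the powers of B are bounded, hence |B v| <= |v|. By scaling,
   |B v| <= rho * |v| whenever all eigenvalues of B have modulus at most rho; take B = A^* A and use
   |A v|^2 = <v, B v> <= |v| * |B v|. *)

section \<open>Euclidean norm and inner product of complex vectors\<close>

definition cnorm :: "complex vec \<Rightarrow> real" where
  "cnorm v = L2_set (\<lambda>i. cmod (v $ i)) {..<dim_vec v}"

lemma cnorm_nonneg [simp]: "0 \<le> cnorm v"
  by (simp add: cnorm_def)

lemma cnorm_eq_0_iff: "v \<in> carrier_vec n \<Longrightarrow> cnorm v = 0 \<longleftrightarrow> v = 0\<^sub>v n"
  by (auto simp: cnorm_def L2_set_eq_0_iff)

lemma cnorm_smult: "cnorm (c \<cdot>\<^sub>v v) = cmod c * cnorm v"
  by (auto simp: cnorm_def L2_set_right_distrib norm_mult intro!: L2_set_cong)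

lemma cscalar_prod_self: "v \<bullet>c v = complex_of_real ((cnorm v)\<^sup>2)"
  by (simp add: cnorm_def L2_set_def sum_nonneg scalar_prod_def atLeast0LessThan
      complex_norm_square del: of_real_power)

lemma cscalar_prod_Cauchy_Schwarz:
  assumes "dim_vec v = dim_vec w"
  shows "cmod (v \<bullet>c w) \<le> cnorm v * cnorm w"
proof -
  have "cmod (v \<bullet>c w) \<le> (\<Sum>i<dim_vec w. \<bar>cmod (v $ i)\<bar> * \<bar>cmod (w $ i)\<bar>)"
    unfolding scalar_prod_def
    by (rule order_trans[OF norm_sum]) (simp add: norm_mult atLeast0LessThan)
  also have "\<dots> \<le> cnorm v * cnorm w"
    unfolding cnorm_def assms by (rule L2_set_mult_ineq)
  finally show ?thesis .
qed

text \<open>Both sides expand to one double sum, taken in the two possible orders; the conjugation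
  built into \<open>\<bullet>c\<close> turns entries of the adjoint back into entries of
  \<open>A\<close>.\<close>

lemma cscalar_prod_adjoint:
  fixes A :: "complex mat"
  assumes A: "A \<in> carrier_mat m n" and v: "v \<in> carrier_vec n" and w: "w \<in> carrier_vec m"
  shows "(A *\<^sub>v v) \<bullet>c w = v \<bullet>c (mat_adjoint A *\<^sub>v w)"
proof -
  note A' = mat_adjoint_carrier[OF A]
  have "(A *\<^sub>v v) \<bullet>c w = (\<Sum>j<m. \<Sum>i<n. A $$ (j, i) * v $ i * cnj (w $ j))"
    using A v w by (simp add: scalar_prod_def atLeast0LessThan sum_distrib_right)
  also have "\<dots> = (\<Sum>i<n. \<Sum>j<m. A $$ (j, i) * v $ i * cnj (w $ j))"
    by (rule sum.swap)
  also have "\<dots> = (\<Sum>i<n. v $ i * cnj (\<Sum>j<m. mat_adjoint A $$ (i, j) * w $ j))"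
    by (simp add: mat_adjoint_index[OF A] sum_distrib_left mult_ac)
  also have "\<dots> = v \<bullet>c (mat_adjoint A *\<^sub>v w)"
    using A' v w by (simp add: scalar_prod_def atLeast0LessThan)
  finally show ?thesis .
qed

lemma mat_adjoint_gram:
  fixes A :: "complex mat"
  assumes A: "A \<in> carrier_mat m n"
  shows "mat_adjoint (mat_adjoint A * A) = mat_adjoint A * A"
proof -
  note A' = mat_adjoint_carrier[OF A]
  have B: "mat_adjoint A * A \<in> carrier_mat n n"
    using A A' by auto
  have "mat_adjoint (mat_adjoint A * A) $$ (i, j) = (mat_adjoint A * A) $$ (i, j)"
    if "i < n" "j < n" for i j
    using that A A'
    by (simp add: mat_adjoint_index[OF B] mat_adjoint_index[OF A] scalar_prod_def mult.commute)
  then show ?thesis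
    using B mat_adjoint_carrier[OF B]
    by (intro eq_matI) (simp_all only: carrier_matD)
qed

text \<open>Moving one factor \<open>A\<close> across the inner product turns the left side into the
  pairing of \<open>v\<close> with its image under the Gram matrix; Cauchy-Schwarz does the
  rest.\<close>

lemma cnorm_mult_mat_vec_sq_le:
  assumes A: "A \<in> carrier_mat m n" and v: "v \<in> carrier_vec n"
  shows "(cnorm (A *\<^sub>v v))\<^sup>2 \<le> cnorm v * cnorm ((mat_adjoint A * A) *\<^sub>v v)"
proof -
  note A' = mat_adjoint_carrier[OF A]
  have Av: "A *\<^sub>v v \<in> carrier_vec m"
    using A v by simp
  have "(cnorm (A *\<^sub>v v))\<^sup>2 = cmod ((A *\<^sub>v v) \<bullet>c (A *\<^sub>v v))"
    by (simp add: cscalar_prod_self del: of_real_power)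
  also have "\<dots> = cmod (v \<bullet>c ((mat_adjoint A * A) *\<^sub>v v))"
    unfolding cscalar_prod_adjoint[OF A v Av] assoc_mult_mat_vec[OF A' A v] ..
  also have "\<dots> \<le> cnorm v * cnorm ((mat_adjoint A * A) *\<^sub>v v)"
    using A A' v by (intro cscalar_prod_Cauchy_Schwarz) simp
  finally show ?thesis .
qed

section \<open>Log-convex growth and bounded matrix powers\<close>

text \<open>Log-convexity says that successive ratios never decrease, so each is at least the first
  one, and \<open>k\<close> of them multiply up to at least its \<open>k\<close>-th power.\<close>

lemma log_convex_growth:
  fixes a :: "nat \<Rightarrow> real"
  assumes nonneg: "\<And>k. 0 \<le> a k"
    and convex: "\<And>k. (a (Suc k))\<^sup>2 \<le> a k * a (Suc (Suc k))"
    and pos: "0 < a 0"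
  shows "(a 1 / a 0) ^ k * a 0 \<le> a k"
proof -
  define r where "r = a 1 / a 0"
  have r: "0 \<le> r"
    using nonneg pos by (simp add: r_def)
  \<comment> \<open>The ratio comparison in product form, which keeps its meaning at vanishing
    terms.\<close>
  have step: "r * a k \<le> a (Suc k)" for k
  proof (induction k)
    case 0
    show ?case using pos by (simp add: r_def)
  next
    case (Suc k)
    show ?case
    proof (cases "a k = 0")
      case True
      then have "a (Suc k) = 0"
        using convex[of k] by simp
      then show ?thesis using nonneg by simp
    next
      case False
      then have ak: "0 < a k"
        using nonneg[of k] by simp
      have "a k * (r * a (Suc k)) = (r * a k) * a (Suc k)"
        by simp
      also have "\<dots> \<le> a (Suc k) * a (Suc k)"
        using Suc nonneg by (rule mult_right_mono)
      also have "\<dots> \<le> a k * a (Suc (Suc k))"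
        using convex[of k] by (simp add: power2_eq_square)
      finally show ?thesis
        using ak by simp
    qed
  qed
  have "r ^ k * a 0 \<le> a k"
  proof (induction k)
    case (Suc k)
    have "r ^ Suc k * a 0 \<le> r * a k"
      using mult_left_mono[OF Suc r] by (simp add: mult_ac)
    then show ?case using step[of k] by linarith
  qed simp
  then show ?thesis by (simp add: r_def)
qed

text \<open>Boundedness is available for matrix powers, growth for iterates on a vector; this links
  the two.\<close>

lemma pow_mat_mult_vec:
  assumes A: "A \<in> carrier_mat n n" and v: "v \<in> carrier_vec n"
  shows "(A ^\<^sub>m k) *\<^sub>v v = (((*\<^sub>v) A) ^^ k) v"
  using v
proof (induction k arbitrary: v)
  case 0
  then show ?case using A by simp
next
  case (Suc k)
  have "(A ^\<^sub>m Suc k) *\<^sub>v v = (A ^\<^sub>m k) *\<^sub>v (A *\<^sub>v v)"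
    using assoc_mult_mat_vec[OF pow_carrier_mat[OF A] A Suc.prems] by simp
  also have "\<dots> = (((*\<^sub>v) A) ^^ k) (A *\<^sub>v v)"
    using A Suc.prems by (intro Suc.IH) simp
  finally show ?case by (simp add: funpow_swap1)
qed

text \<open>A crude estimate suffices: the matrix enters the right side only through
  \<open>b\<close> and its dimensions, so an entrywise bound shared by all powers bounds all
  iterates at once.\<close>

lemma cnorm_norm_bound_le:
  assumes A: "A \<in> carrier_mat m n" and b: "norm_bound A b" and v: "v \<in> carrier_vec n"
  shows "cnorm (A *\<^sub>v v) \<le> (\<Sum>i<m. \<Sum>j<n. b * cmod (v $ j))"
proof -
  have "cnorm (A *\<^sub>v v) \<le> (\<Sum>i<m. cmod ((A *\<^sub>v v) $ i))"
    unfolding cnorm_def using A by (intro order_trans[OF L2_set_le_sum]) simp_all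
  also have "\<dots> \<le> (\<Sum>i<m. \<Sum>j<n. b * cmod (v $ j))"
  proof (rule sum_mono)
    fix i assume i: "i \<in> {..<m}"
    have "cmod ((A *\<^sub>v v) $ i) = cmod (\<Sum>j<n. A $$ (i, j) * v $ j)"
      using A v i by (simp add: scalar_prod_def atLeast0LessThan)
    also have "\<dots> \<le> (\<Sum>j<n. cmod (A $$ (i, j)) * cmod (v $ j))"
      by (rule order_trans[OF norm_sum]) (simp add: norm_mult)
    also have "\<dots> \<le> (\<Sum>j<n. b * cmod (v $ j))"
      using A b i by (intro sum_mono mult_right_mono) (auto simp: norm_bound_def)
    finally show "cmod ((A *\<^sub>v v) $ i) \<le> (\<Sum>j<n. b * cmod (v $ j))" .
  qed
  finally show ?thesis .
qed

section \<open>Norm bounds for Hermitian matrices\<close>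

lemma hermitian_contraction:
  fixes B :: "complex mat"
  assumes B: "B \<in> carrier_mat n n" and herm: "mat_adjoint B = B"
    and radius: "spectral_radius B < 1" and v: "v \<in> carrier_vec n"
  shows "cnorm (B *\<^sub>v v) \<le> cnorm v"
proof (cases "cnorm v = 0")
  case True
  then show ?thesis
    using cnorm_mult_mat_vec_sq_le[OF B v] by simp
next
  case False
  then have pos: "0 < cnorm v"
    using cnorm_nonneg[of v] by linarith
  define u where "u = (\<lambda>k. (((*\<^sub>v) B) ^^ k) v)"
  define r where "r = cnorm (B *\<^sub>v v) / cnorm v"
  have u: "u k \<in> carrier_vec n" for k
    using B v by (induction k) (simp_all add: u_def)
  \<comment> \<open>As \<open>B\<close> is its own adjoint, its Gram matrix is \<open>B * B\<close>,
    which carries \<open>u k\<close> to \<open>u (Suc (Suc k))\<close>.\<close>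
  have "(cnorm (u (Suc k)))\<^sup>2 \<le> cnorm (u k) * cnorm (u (Suc (Suc k)))" for k
    using cnorm_mult_mat_vec_sq_le[OF B u[of k]] assoc_mult_mat_vec[OF B B u[of k]]
    by (simp add: herm u_def)
  from log_convex_growth[of "\<lambda>k. cnorm (u k)", OF _ this]
  have growth: "r ^ k * cnorm v \<le> cnorm (u k)" for k
    using pos by (simp add: u_def r_def)
  \<comment> \<open>Strictness of the radius bound matters here: at radius 1 a nontrivial Jordan
    block could make the powers grow.\<close>
  obtain b where b: "\<And>k. norm_bound (B ^\<^sub>m k) b"
    using spectral_radius_jnf_norm_bound_less_1_upper_triangular[OF B radius] by blast
  define K where "K = (\<Sum>i<n. \<Sum>j<n. b * cmod (v $ j))"
  have bounded: "cnorm (u k) \<le> K" for k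
    using cnorm_norm_bound_le[OF pow_carrier_mat[OF B] b v]
    by (simp add: u_def K_def pow_mat_mult_vec[OF B v])
  have "r \<le> 1"
  proof (rule ccontr)
    assume "\<not> r \<le> 1"
    then obtain k where "K / cnorm v < r ^ k"
      using real_arch_pow[of r] by auto
    then have "K < r ^ k * cnorm v"
      using pos by (simp add: field_simps)
    then show False
      using growth[of k] bounded[of k] by linarith
  qed
  then show ?thesis
    using pos by (simp add: r_def)
qed

text \<open>Dividing by any \<open>c\<close> above \<rho> gives the strict spectral bound that the
  contraction lemma demands; the slack disappears as \<open>c\<close> tends to \<rho>.\<close>

lemma hermitian_cnorm_le:
  fixes B :: "complex mat"
  assumes B: "B \<in> carrier_mat n n" and herm: "mat_adjoint B = B"
    and ev: "\<And>l. eigenvalue B l \<Longrightarrow> cmod l \<le> \<rho>" and v: "v \<in> carrier_vec n" and n: "0 < n"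
  shows "cnorm (B *\<^sub>v v) \<le> \<rho> * cnorm v"
proof -
  \<comment> \<open>Some eigenvalue exists in positive dimension, and its modulus forces \<rho> to
    be nonnegative; hence every \<open>c\<close> above \<rho> is a valid divisor.\<close>
  obtain l where "eigenvalue B l"
    using spectrum_non_empty[OF B] n by (auto simp: spectrum_def)
  then have \<rho>: "0 \<le> \<rho>"
    using ev norm_ge_zero order_trans by blast
  have scaled: "cnorm (B *\<^sub>v v) \<le> c * cnorm v" if c: "\<rho> < c" for c
  proof -
    have c0: "0 < c"
      using \<rho> c by simp
    define M where "M = complex_of_real (1 / c) \<cdot>\<^sub>m B"
    have M: "M \<in> carrier_mat n n"
      using B by (simp add: M_def)
    have "mat_adjoint M $$ (i, j) = M $$ (i, j)" if "i < n" "j < n" for i j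
      using that B mat_adjoint_index[OF M that] mat_adjoint_index[OF B that]
      by (simp add: M_def herm)
    then have "mat_adjoint M = M"
      using M mat_adjoint_carrier[OF M] by (intro eq_matI) auto
    moreover have "spectral_radius M < 1"
    proof -
      obtain l where l: "eigenvalue M l" "spectral_radius M = cmod l"
        using spectral_radius_mem_max(1)[OF M n] by (auto simp: spectrum_def)
      then obtain w where w: "w \<in> carrier_vec n" "w \<noteq> 0\<^sub>v n" "M *\<^sub>v w = l \<cdot>\<^sub>v w"
        using M by (auto simp: eigenvalue_def eigenvector_def)
      have "B *\<^sub>v w = complex_of_real c \<cdot>\<^sub>v (M *\<^sub>v w)"
        using B w(1) c0 by (intro eq_vecI) (auto simp: M_def)
      also have "\<dots> = (complex_of_real c * l) \<cdot>\<^sub>v w"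
        by (simp add: w(3) smult_smult_assoc)
      finally have "eigenvalue B (complex_of_real c * l)"
        using B w by (auto simp: eigenvalue_def eigenvector_def)
      from ev[OF this] have "c * cmod l \<le> \<rho>"
        using c0 by (simp add: norm_mult)
      then have "c * cmod l < c * 1"
        using c by linarith
      then show ?thesis
        using c0 l by simp
    qed
    ultimately have "cnorm (M *\<^sub>v v) \<le> cnorm v"
      using hermitian_contraction[OF M] v by blast
    moreover have "M *\<^sub>v v = complex_of_real (1 / c) \<cdot>\<^sub>v (B *\<^sub>v v)"
      using B v by (intro eq_vecI) (auto simp: M_def)
    ultimately show ?thesis
      using c0 by (simp add: cnorm_smult norm_divide field_simps)
  qed
  show ?thesis
  proof (rule field_le_epsilon)
    fix e :: real assume e: "0 < e"
    \<comment> \<open>The added 1 keeps the denominator positive even when \<open>v\<close> is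
      zero.\<close>
    define d where "d = e / (cnorm v + 1)"
    have d: "0 < d" "d * cnorm v \<le> e"
      using e cnorm_nonneg[of v] by (simp_all add: d_def field_simps add_pos_nonneg)
    show "cnorm (B *\<^sub>v v) \<le> \<rho> * cnorm v + e"
      using scaled[of "\<rho> + d"] d by (simp add: distrib_right)
  qed
qed

section \<open>Eigenvalues of the Gram matrix and the largest singular value\<close>

text \<open>The eigenvector equation is used in the second, conjugate-linear slot of the inner
  product, whence \<open>cnj l\<close>. For nonzero \<open>v\<close> this makes \<open>l\<close>
  real and nonnegative.\<close>

lemma gram_eigenvector:
  fixes A :: "complex mat"
  assumes A: "A \<in> carrier_mat m n" and v: "v \<in> carrier_vec n"
    and ev: "(mat_adjoint A * A) *\<^sub>v v = l \<cdot>\<^sub>v v"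
  shows "complex_of_real ((cnorm (A *\<^sub>v v))\<^sup>2) = cnj l * complex_of_real ((cnorm v)\<^sup>2)"
proof -
  note A' = mat_adjoint_carrier[OF A]
  have Av: "A *\<^sub>v v \<in> carrier_vec m"
    using A v by simp
  have "(A *\<^sub>v v) \<bullet>c (A *\<^sub>v v) = v \<bullet>c (l \<cdot>\<^sub>v v)"
    unfolding cscalar_prod_adjoint[OF A v Av] assoc_mult_mat_vec[OF A' A v, symmetric] ev ..
  also have "\<dots> = cnj l * (v \<bullet>c v)"
    using v by (simp add: conjugate_smult_vec)
  finally show ?thesis
    by (simp only: cscalar_prod_self)
qed

lemma sigma_max_in_singular_values:
  assumes "A \<in> carrier_mat m n" "0 < n"
  shows "sigma_max A \<in> singular_values A"
  unfolding sigma_max_def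
  using finite_singular_values singular_values_nonempty assms by (blast intro: Max_in)

lemma sigma_max_nonneg:
  assumes "A \<in> carrier_mat m n" "0 < n"
  shows "0 \<le> sigma_max A"
  using sigma_max_in_singular_values[OF assms] by (simp add: singular_values_def)

text \<open>\<open>singular_values\<close> records only eigenvalues that are squares of nonnegative
  reals, so its maximum controls the whole spectrum once every eigenvalue is shown to have this
  form.\<close>

lemma gram_eigenvalue_le:
  assumes A: "A \<in> carrier_mat m n" and ev: "eigenvalue (mat_adjoint A * A) l"
  shows "cmod l \<le> (sigma_max A)\<^sup>2"
proof -
  obtain v where v: "v \<in> carrier_vec n" "v \<noteq> 0\<^sub>v n" "(mat_adjoint A * A) *\<^sub>v v = l \<cdot>\<^sub>v v"
    using ev mat_adjoint_carrier[OF A] by (auto simp: eigenvalue_def eigenvector_def)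
  \<comment> \<open>The candidate singular value is the factor by which \<open>A\<close> stretches
    the eigenvector.\<close>
  define s where "s = cnorm (A *\<^sub>v v) / cnorm v"
  have pos: "cnorm v \<noteq> 0"
    using v cnorm_eq_0_iff by blast
  have "cnj l = complex_of_real (s\<^sup>2)"
    using gram_eigenvector[OF A v(1,3)] pos by (simp add: s_def power_divide field_simps)
  then have l: "l = complex_of_real (s\<^sup>2)"
    by (metis complex_cnj_cnj complex_cnj_complex_of_real)
  then have "s \<in> singular_values A"
    using ev by (simp add: singular_values_def s_def)
  then have "s \<le> sigma_max A"
    unfolding sigma_max_def using finite_singular_values[OF A] by simp
  moreover have "0 \<le> s"
    by (simp add: s_def)
  ultimately show ?thesis
    by (simp add: l norm_power power_mono)
qed

lemma cnorm_le_sigma_max: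
  assumes A: "A \<in> carrier_mat m n" and v: "v \<in> carrier_vec n" and n: "0 < n"
  shows "cnorm (A *\<^sub>v v) \<le> sigma_max A * cnorm v"
proof -
  have B: "mat_adjoint A * A \<in> carrier_mat n n"
    using A mat_adjoint_carrier[OF A] by simp
  have "(cnorm (A *\<^sub>v v))\<^sup>2 \<le> cnorm v * cnorm ((mat_adjoint A * A) *\<^sub>v v)"
    by (rule cnorm_mult_mat_vec_sq_le[OF A v])
  \<comment> \<open>The Hermitian bound applies to the Gram matrix with \<rho> equal to
    \<open>(sigma_max A)\<^sup>2\<close>.\<close>
  also have "\<dots> \<le> cnorm v * ((sigma_max A)\<^sup>2 * cnorm v)"
    using hermitian_cnorm_le[OF B mat_adjoint_gram[OF A] gram_eigenvalue_le[OF A] v n]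
    by (simp add: mult_left_mono)
  also have "\<dots> = (sigma_max A * cnorm v)\<^sup>2"
    by (simp add: power2_eq_square mult_ac)
  finally show ?thesis
    by (rule power2_le_imp_le) (simp add: sigma_max_nonneg[OF A n])
qed

text \<open>An eigenvector of the Gram matrix for the eigenvalue
  \<open>(sigma_max A)\<^sup>2\<close> is stretched by exactly \<open>sigma_max A\<close>.\<close>

lemma sigma_max_attained:
  assumes A: "A \<in> carrier_mat m n" and n: "0 < n"
  obtains v where "v \<in> carrier_vec n" "0 < cnorm v" "cnorm (A *\<^sub>v v) = sigma_max A * cnorm v"
proof -
  have "eigenvalue (mat_adjoint A * A) (complex_of_real ((sigma_max A)\<^sup>2))"
    using sigma_max_in_singular_values[OF assms] by (simp add: singular_values_def)
  then obtain v where v: "v \<in> carrier_vec n" "v \<noteq> 0\<^sub>v n"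
      "(mat_adjoint A * A) *\<^sub>v v = complex_of_real ((sigma_max A)\<^sup>2) \<cdot>\<^sub>v v"
    using mat_adjoint_carrier[OF A] A by (auto simp: eigenvalue_def eigenvector_def)
  have "(cnorm (A *\<^sub>v v))\<^sup>2 = (sigma_max A)\<^sup>2 * (cnorm v)\<^sup>2"
    using gram_eigenvector[OF A v(1,3)]
    by (simp only: complex_cnj_complex_of_real of_real_mult[symmetric] of_real_eq_iff)
  then have "cnorm (A *\<^sub>v v) = sigma_max A * cnorm v"
    using sigma_max_nonneg[OF assms]
    by (simp add: power_mult_distrib[symmetric] power2_eq_iff_nonneg)
  moreover have "0 < cnorm v"
    using v(1,2) cnorm_eq_0_iff cnorm_nonneg[of v] by (metis less_eq_real_def)
  ultimately show thesis
    using v(1) that by blast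
qed

section \<open>Submultiplicativity and the self-interference constraints\<close>

text \<open>A vector stretched maximally by the product is followed through both factors. Positive
  \<open>m\<close> and \<open>n\<close> keep all three maxima over nonempty sets.\<close>

lemma sigma_max_mult_le:
  assumes A: "A \<in> carrier_mat l m" and B: "B \<in> carrier_mat m n" and m: "0 < m" and n: "0 < n"
  shows "sigma_max (A * B) \<le> sigma_max A * sigma_max B"
proof -
  have AB: "A * B \<in> carrier_mat l n"
    using A B by simp
  obtain v where v: "v \<in> carrier_vec n" and pos: "0 < cnorm v"
      and max: "cnorm ((A * B) *\<^sub>v v) = sigma_max (A * B) * cnorm v"
    using sigma_max_attained[OF AB n] .
  have Bv: "B *\<^sub>v v \<in> carrier_vec m"
    using B v by simp
  have "sigma_max (A * B) * cnorm v = cnorm (A *\<^sub>v (B *\<^sub>v v))"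
    using max assoc_mult_mat_vec[OF A B v] by simp
  also have "\<dots> \<le> sigma_max A * cnorm (B *\<^sub>v v)"
    by (rule cnorm_le_sigma_max[OF A Bv m])
  also have "\<dots> \<le> sigma_max A * (sigma_max B * cnorm v)"
    using cnorm_le_sigma_max[OF B v n] sigma_max_nonneg[OF A m] by (rule mult_left_mono)
  finally show ?thesis
    using pos by (simp add: mult.assoc[symmetric])
qed

theorem theorem4:
  fixes N\<^sub>t N\<^sub>r L\<^sub>t L\<^sub>r N\<^sub>s :: nat
    and H F_RF F_BB W_RF :: "complex mat"
    and \<eta>_LNA \<eta>_ADC :: real
  assumes "N\<^sub>t \<ge> 1" and "N\<^sub>r \<ge> 1" and "L\<^sub>t \<ge> 1" and "L\<^sub>r \<ge> 1" and "N\<^sub>s \<ge> 1"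
    and "H \<in> carrier_mat N\<^sub>r N\<^sub>t"
    and "F_RF \<in> carrier_mat N\<^sub>t L\<^sub>t"
    and "F_BB \<in> carrier_mat L\<^sub>t N\<^sub>s"
    and "W_RF \<in> carrier_mat N\<^sub>r L\<^sub>r"
    and "\<eta>_LNA \<ge> 0" and "\<eta>_ADC \<ge> 0"
    and "1 / real N\<^sub>s * (sigma_max (H * F_RF * F_BB))\<^sup>2 \<le> \<eta>_LNA"
    and "\<eta>_ADC \<ge> \<eta>_LNA * (sigma_max (mat_adjoint W_RF))\<^sup>2"
  shows "1 / real N\<^sub>s * (sigma_max (mat_adjoint W_RF * H * F_RF * F_BB))\<^sup>2 \<le> \<eta>_ADC"
proof -
  define S where "S = H * F_RF * F_BB"
  define W where "W = mat_adjoint W_RF"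
  have W: "W \<in> carrier_mat L\<^sub>r N\<^sub>r"
    using assms(9) by (simp add: W_def mat_adjoint_carrier)
  have S: "S \<in> carrier_mat N\<^sub>r N\<^sub>s"
    using assms(6-8) by (simp add: S_def)
  have WS: "W * S \<in> carrier_mat L\<^sub>r N\<^sub>s"
    using W S by simp
  \<comment> \<open>Regrouping exposes the adjoint combiner as a left factor of the matrix in the
    per-antenna constraint.\<close>
  have "W * H * F_RF * F_BB = W * S"
    using W assms(6-8) by (simp add: S_def assoc_mult_mat[of _ L\<^sub>r N\<^sub>r _ L\<^sub>t _ N\<^sub>s]
        assoc_mult_mat[of _ L\<^sub>r N\<^sub>r _ N\<^sub>t _ L\<^sub>t])
  moreover have "1 / real N\<^sub>s * (sigma_max (W * S))\<^sup>2 \<le> \<eta>_ADC"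
  proof -
    have "(sigma_max (W * S))\<^sup>2 \<le> (sigma_max W * sigma_max S)\<^sup>2"
      using sigma_max_mult_le[OF W S] sigma_max_nonneg[OF WS] assms(2,5)
      by (intro power_mono) auto
    then have "1 / real N\<^sub>s * (sigma_max (W * S))\<^sup>2
        \<le> 1 / real N\<^sub>s * (sigma_max W * sigma_max S)\<^sup>2"
      by (rule mult_left_mono) simp
    \<comment> \<open>The normalisation by the number of streams stays with \<open>S\<close>, so
      that the per-antenna constraint applies verbatim.\<close>
    also have "\<dots> = (1 / real N\<^sub>s * (sigma_max S)\<^sup>2) * (sigma_max W)\<^sup>2"
      by (simp add: power_mult_distrib)
    also have "\<dots> \<le> \<eta>_LNA * (sigma_max W)\<^sup>2"
      using assms(12) by (intro mult_right_mono) (auto simp: S_def)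
    also have "\<dots> \<le> \<eta>_ADC"
      using assms(13) by (simp add: W_def)
    finally show ?thesis .
  qed
  ultimately show ?thesis
    by (simp add: W_def)
qed

end
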